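(* Let $l_x,l_y,l_z,u_z$ be real numbers with $0<l_z<u_z<1$, $l_z\le l_x\le u_z$, $l_z\le l_y\le u_z$ and $l_xl_y<l_z$. Suppose that $(l_x,l_y)$ is in region D, i.e. $l_x\ge l_z$, $\sqrt{l_z/u_z}\le l_y\le u_z$ and $l_xl_y\le l_z$. Let $\mathcal F'=\{(x,y,z)\in\mathbb R^3 : z=xy,\ l_x\le x\le 1,\ l_y\le y\le 1,\ l_z\le z\le u_z\}$, let $$M_2=\begin{pmatrix}1 & 2l_z-u_z\\ 2l_z-u_z & u_z^2\end{pmatrix}$$ (which is positive semidefinite), and let $$a=\frac{u_zl_y^2-l_z}{u_zl_y-l_z},\qquad b=\frac{l_y(1-l_y)}{u_zl_y-l_z}.$$ Then $\operatorname{conv}(\mathcal F')$ is exactly the set of $(x,y,z)\in\mathbb R^3$ satisfying the RLT constraints $$z\ge x+y-1,\qquad z\ge l_yx+l_xy-l_xl_y,\qquad z\le x+l_xy-l_x,\qquad z\le l_yx+y-l_y,$$ the bounds $l_z\le z\le u_z$, and the following two second-order cone constraints, each imposed only when $(x,y)$ is in the indicated region: 1. if $y\le a+bx$, then, with $l_x':=l_z/l_y$, $$u_z(z-l_x'l_y)^2\le\big(u_z(x-l_x')+l_x'(z-l_yx)\big)\big(u_z(y-l_y)+l_y(z-l_x'y)\big);$$ 2. if $y\ge a+bx$, then $\sqrt{(\hat x,\hat y)M_2(\hat x,\hat y)^T}\le x+u_zy-2z$, where $\hat x:=u_z-x$, $\hat y:=1-y$.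
   Context: $\operatorname{conv}$ denotes the convex hull in $\mathbb R^3$. "RLT" stands for Reformulation-Linearization Technique; the RLT constraints are written out in the claim for the box $l_x\le x\le 1$, $l_y\le y\le 1$. The line $y=a+bx$ is the line through the points $(l_z/l_y,l_y)$ and $(u_z,1)$. *)

theory Defs
  imports "HOL-Analysis.Analysis"
begin

definition region_D :: "real \<Rightarrow> real \<Rightarrow> real \<Rightarrow> real \<Rightarrow> bool" where
  "region_D lx ly lz uz \<longleftrightarrow>
     lx \<ge> lz \<and> sqrt (lz / uz) \<le> ly \<and> ly \<le> uz \<and> lx * ly \<le> lz"

definition bilinear_set :: "real \<Rightarrow> real \<Rightarrow> real \<Rightarrow> real \<Rightarrow> (real \<times> real \<times> real) set" where
  "bilinear_set lx ly lz uz =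
     {(x, y, z). z = x * y \<and> lx \<le> x \<and> x \<le> 1 \<and> ly \<le> y \<and> y \<le> 1 \<and> lz \<le> z \<and> z \<le> uz}"

definition rlt_constraints :: "real \<Rightarrow> real \<Rightarrow> real \<Rightarrow> real \<Rightarrow> real \<Rightarrow> bool" where
  "rlt_constraints lx ly x y z \<longleftrightarrow>
     z \<ge> x + y - 1 \<and> z \<ge> ly * x + lx * y - lx * ly \<and>
     z \<le> x + lx * y - lx \<and> z \<le> ly * x + y - ly"

definition quad_form :: "real ^ 'n ^ 'n \<Rightarrow> real ^ 'n \<Rightarrow> real" where
  "quad_form M v = v \<bullet> (M *v v)"

definition pos_semidef :: "real ^ 'n ^ 'n \<Rightarrow> bool" where
  "pos_semidef M \<longleftrightarrow> transpose M = M \<and> (\<forall>v. 0 \<le> quad_form M v)"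

definition M2 :: "real \<Rightarrow> real \<Rightarrow> real ^ 2 ^ 2" where
  "M2 lz uz = vector [vector [1, 2 * lz - uz], vector [2 * lz - uz, uz\<^sup>2]]"

text \<open>The line \<open>y = line_a + line_b * x\<close> passes through the points
  \<open>(lz / ly, ly)\<close> and \<open>(uz, 1)\<close>.\<close>

definition line_a :: "real \<Rightarrow> real \<Rightarrow> real \<Rightarrow> real" where
  "line_a ly lz uz = (uz * ly\<^sup>2 - lz) / (uz * ly - lz)"

definition line_b :: "real \<Rightarrow> real \<Rightarrow> real \<Rightarrow> real" where
  "line_b ly lz uz = ly * (1 - ly) / (uz * ly - lz)"

definition soc_below_line :: "real \<Rightarrow> real \<Rightarrow> real \<Rightarrow> real \<Rightarrow> real \<Rightarrow> real \<Rightarrow> bool" where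
  "soc_below_line ly lz uz x y z \<longleftrightarrow>
     (let lx' = lz / ly in
        uz * (z - lx' * ly)\<^sup>2
          \<le> (uz * (x - lx') + lx' * (z - ly * x)) * (uz * (y - ly) + ly * (z - lx' * y)))"

definition soc_above_line :: "real \<Rightarrow> real \<Rightarrow> real \<Rightarrow> real \<Rightarrow> real \<Rightarrow> bool" where
  "soc_above_line lz uz x y z \<longleftrightarrow>
     sqrt (quad_form (M2 lz uz) (vector [uz - x, 1 - y])) \<le> x + uz * y - 2 * z"

end

theory Submission
  imports Defs
begin

text \<open>
  Put \<open>k = lz / ly\<close>. The convex hull is the union of three bodies: the polytope with vertices
  \<open>P = (k, ly, lz)\<close>, \<open>R = (lx, lz / lx, lz)\<close>, \<open>E = (lx, 1, lx)\<close>, \<open>P' = (uz, 1, uz)\<close>,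
  \<open>Q = (1, uz, uz)\<close>, \<open>G = (1, ly, ly)\<close>; the cone with apex \<open>P\<close> over the lens between the arc
  \<open>xy = uz\<close> and its chord \<open>P'Q\<close>; and the cone with apex \<open>P'\<close> over the lens between the arc
  \<open>xy = lz\<close> and its chord \<open>PR\<close>. The two second-order cone constraints describe these cones, and the
  line \<open>y = a + b x\<close> is the vertical plane through the common edge \<open>PP'\<close>.

  The constraints hold on the hull because every plane tangent to one of the cones along a ruling
  through its arc is valid on the bilinear set: for fixed \<open>y\<close> it is affine in \<open>x\<close>, so it suffices
  to look at \<open>xy = lz\<close> and \<open>xy = uz\<close>, and there region D is exactly what is needed.
  Conversely, a point beyond a chord plane \<open>PP'Q\<close> or \<open>PP'R\<close> is projected from the apex to the
  lens, and the polytope is cut into the tetrahedra \<open>PP'RE\<close>, \<open>PP'EG\<close>, \<open>PP'GQ\<close> around the edge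
  \<open>PP'\<close>.
\<close>

section \<open>Barycentric coordinates in a tetrahedron\<close>

text \<open>This is the determinant of the edge vectors from the first point, six times the signed
  volume.\<close>

fun tet_volume :: "real \<times> real \<times> real \<Rightarrow> real \<times> real \<times> real \<Rightarrow> real \<times> real \<times> real \<Rightarrow> real \<times> real \<times> real \<Rightarrow> real"
  where "tet_volume (a1, a2, a3) (b1, b2, b3) (c1, c2, c3) (d1, d2, d3) =
    (b1 - a1) * ((c2 - a2) * (d3 - a3) - (c3 - a3) * (d2 - a2)) -
    (b2 - a2) * ((c1 - a1) * (d3 - a3) - (c3 - a3) * (d1 - a1)) +
    (b3 - a3) * ((c1 - a1) * (d2 - a2) - (c2 - a2) * (d1 - a1))"

lemma tet_volume_sum:
  "tet_volume p b c d + tet_volume a p c d + tet_volume a b p d + tet_volume a b c p =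
   tet_volume a b c d"
proof -
  obtain a1 a2 a3 b1 b2 b3 c1 c2 c3 d1 d2 d3 p1 p2 p3 where
    "a = (a1, a2, a3)" "b = (b1, b2, b3)" "c = (c1, c2, c3)" "d = (d1, d2, d3)" "p = (p1, p2, p3)"
    by (metis prod.collapse)
  then show ?thesis
    by (simp add: algebra_simps)
qed

text \<open>Cramer's rule without division: the barycentric coordinates of \<open>p\<close> are
  ratios of signed volumes.\<close>

lemma tet_volume_Cramer:
  "tet_volume p b c d *\<^sub>R a + tet_volume a p c d *\<^sub>R b + tet_volume a b p d *\<^sub>R c +
   tet_volume a b c p *\<^sub>R d = tet_volume a b c d *\<^sub>R p"
proof -
  obtain a1 a2 a3 b1 b2 b3 c1 c2 c3 d1 d2 d3 p1 p2 p3 where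
    "a = (a1, a2, a3)" "b = (b1, b2, b3)" "c = (c1, c2, c3)" "d = (d1, d2, d3)" "p = (p1, p2, p3)"
    by (metis prod.collapse)
  then show ?thesis
    by (simp add: algebra_simps)
qed

lemma convex_tetrahedron:
  assumes "convex S" "a \<in> S" "b \<in> S" "c \<in> S" "d \<in> S"
    and V: "0 < tet_volume a b c d"
    and nn: "0 \<le> tet_volume p b c d" "0 \<le> tet_volume a p c d"
            "0 \<le> tet_volume a b p d" "0 \<le> tet_volume a b c p"
  shows "p \<in> S"
proof -
  define V where "V = tet_volume a b c d"
  have V0: "V > 0" using V by (simp add: V_def)
  define s t u v where "s = tet_volume p b c d / V" and "t = tet_volume a p c d / V"
    and "u = tet_volume a b p d / V" and "v = tet_volume a b c p / V"
  have nonneg: "s \<ge> 0" "t \<ge> 0" "u \<ge> 0" "v \<ge> 0"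
    using nn V0 by (auto simp: s_def t_def u_def v_def)
  have sum: "s + t + u + v = 1"
    using tet_volume_sum[of p b c d a] V0
    unfolding s_def t_def u_def v_def add_divide_distrib[symmetric] by (simp add: V_def)
  have "p = (1 / V) *\<^sub>R (V *\<^sub>R p)"
    using V0 by simp
  also have "\<dots> = s *\<^sub>R a + t *\<^sub>R b + u *\<^sub>R c + v *\<^sub>R d"
    unfolding V_def tet_volume_Cramer[of p b c d a, symmetric]
    by (simp add: scaleR_add_right s_def t_def u_def v_def V_def)
  finally have p: "p = s *\<^sub>R a + t *\<^sub>R b + u *\<^sub>R c + v *\<^sub>R d" .
  have "(\<Sum>i<4. [s, t, u, v] ! i *\<^sub>R [a, b, c, d] ! i) \<in> S"
  proof (rule convex_sum)
    show "(\<Sum>i<4. [s, t, u, v] ! i) = 1" using sum by (simp add: eval_nat_numeral)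
    show "0 \<le> [s, t, u, v] ! i" "[a, b, c, d] ! i \<in> S" if "i \<in> {..<4}" for i
      using that nonneg assms(2-5) by (auto simp: eval_nat_numeral less_Suc_eq)
  qed (use assms in auto)
  then show ?thesis unfolding p by (simp add: eval_nat_numeral)
qed

section \<open>The quadratic form of \<open>M2\<close>\<close>

lemma quad_form_M2:
  "quad_form (M2 lz uz) v = (v $ 1)\<^sup>2 + 2 * (2 * lz - uz) * v $ 1 * v $ 2 + uz\<^sup>2 * (v $ 2)\<^sup>2"
  by (simp add: quad_form_def M2_def inner_vec_def matrix_vector_mult_def sum_2 algebra_simps power2_eq_square)

lemma pos_semidef_M2:
  assumes "0 \<le> lz" "lz \<le> uz"
  shows "pos_semidef (M2 lz uz)"
proof -
  have "0 \<le> quad_form (M2 lz uz) v" for v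
  proof -
    let ?a = "v $ 1" and ?b = "v $ 2"
    \<comment> \<open>Scaled by \<open>uz\<close>, the form is a sum of two squares with nonnegative
      weights.\<close>
    have "uz * quad_form (M2 lz uz) v =
        (uz - lz) * (?a - uz * ?b)\<^sup>2 + lz * (?a + uz * ?b)\<^sup>2"
      unfolding quad_form_M2 by algebra
    also have "\<dots> \<ge> 0" using assms by simp
    finally show ?thesis
      using assms by (cases "uz = 0") (auto simp: quad_form_M2 zero_le_mult_iff)
  qed
  moreover have "transpose (M2 lz uz) = M2 lz uz"
    by (simp add: M2_def vec_eq_iff transpose_def forall_2)
  ultimately show ?thesis by (simp add: pos_semidef_def)
qed


section \<open>Half-spaces, hyperbola arcs and the cones over them\<close>

lemma convex_hull_halfspace:
  fixes a b c e :: real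
  assumes "(x, y, z) \<in> convex hull S"
    and "\<And>x y z. (x, y, z) \<in> S \<Longrightarrow> e \<le> a * x + b * y + c * z"
  shows "e \<le> a * x + b * y + c * z"
proof -
  have "convex hull S \<subseteq> {p. inner (a, b, c) p \<ge> e}"
    using assms(2) by (intro hull_minimal convex_halfspace_ge) (auto simp: add.assoc)
  then show ?thesis using assms(1) by auto
qed

lemma convex_vertical_interval:
  fixes S :: "(real \<times> real \<times> real) set"
  assumes "convex S" "(x, y1, z) \<in> S" "(x, y2, z) \<in> S" "y1 \<le> y" "y \<le> y2"
  shows "(x, y, z) \<in> S"
proof (cases "y1 = y2")
  case False
  define u where "u = (y - y1) / (y2 - y1)"
  have u: "0 \<le> u" "u \<le> 1" "u * (y2 - y1) = y - y1" using assms False by (auto simp: u_def)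
  have "(1 - u) *\<^sub>R (x, y1, z) + u *\<^sub>R (x, y2, z) \<in> S"
    using convexD_alt[OF assms(1-3) u(1,2)] .
  moreover have "(1 - u) *\<^sub>R (x, y1, z) + u *\<^sub>R (x, y2, z) = (x, y, z)"
    using u(3) by (simp add: algebra_simps)
  ultimately show ?thesis by simp
qed (use assms in auto)

text \<open>The two inequalities confine \<open>x\<close> to the interval from \<open>a\<close> to
  \<open>b\<close>; the point then lies on a vertical segment from the arc up to the chord.\<close>

lemma hyperbola_lens:
  fixes a b m x y w :: real
  assumes S: "convex S" and m: "0 < m" and ab: "0 < a" "a < b"
    and arc: "\<And>t. a \<le> t \<Longrightarrow> t \<le> b \<Longrightarrow> (t, m / t, w) \<in> S"
    and x: "0 < x" and xy: "m \<le> x * y" and chord: "m * x + a * b * y \<le> m * (a + b)"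
  shows "(x, y, w) \<in> S"
proof -
  define h where "h = m * (a + b - x) / (a * b)"
  \<comment> \<open>Eliminating \<open>y\<close> between arc and chord leaves a quadratic in
    \<open>x\<close> with roots \<open>a\<close> and \<open>b\<close>.\<close>
  have "m * ((x - a) * (x - b)) = x * (m * x + a * b * y - m * (a + b)) - a * b * (x * y - m)"
    by algebra
  also have "\<dots> \<le> 0"
  proof -
    have "0 \<le> a * b * (x * y - m)" using xy ab by (intro mult_nonneg_nonneg) auto
    moreover have "x * (m * x + a * b * y - m * (a + b)) \<le> 0"
      using x chord by (intro mult_nonneg_nonpos) auto
    ultimately show ?thesis by linarith
  qed
  finally have "(x - a) * (x - b) \<le> 0" using m by (simp add: mult_le_0_iff)
  then have x_ab: "a \<le> x" "x \<le> b" using ab by (auto simp: mult_le_0_iff)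
  define u where "u = (x - a) / (b - a)"
  have u: "0 \<le> u" "u \<le> 1" "x = a + u * (b - a)" using x_ab ab by (auto simp: u_def)
  have "(1 - u) *\<^sub>R (a, m / a, w) + u *\<^sub>R (b, m / b, w) \<in> S"
    using convexD_alt[OF S arc[of a] arc[of b] u(1,2)] ab by simp
  moreover have "(1 - u) *\<^sub>R (a, m / a, w) + u *\<^sub>R (b, m / b, w) = (x, h, w)"
    using ab by (simp add: u(3) h_def field_simps)
  ultimately have "(x, h, w) \<in> S" by simp
  moreover have "m / x \<le> y" using xy x by (simp add: field_simps)
  moreover have "y \<le> h" using chord ab by (simp add: h_def field_simps)
  ultimately show ?thesis using convex_vertical_interval[OF S arc[OF x_ab]] by blast
qed

text \<open>The tangent plane that touches the cone over \<open>(s, m / s)\<close> with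
  \<open>s = m * C / B\<close> already gives the cone inequality; \<open>range\<close> says that
  this \<open>s\<close> belongs to the arc.\<close>

lemma hyperbola_cone_from_tangents:
  fixes a b m A B C :: real
  assumes "0 < m" "0 < a" "0 < b" "0 \<le> C"
    and tangent: "\<And>s. a \<le> s \<Longrightarrow> s \<le> b \<Longrightarrow> 2 * m * s * C \<le> m * A + s\<^sup>2 * B"
    and range: "a * B \<le> m * C" "m * C \<le> b * B"
  shows "m * C\<^sup>2 \<le> A * B"
proof (cases "C = 0")
  case True
  then have "B = 0" using assms by (simp add: mult_le_0_iff zero_le_mult_iff)
  with True show ?thesis by simp
next
  case False
  then have "0 < m * C" using assms by simp
  then have "0 < b * B" using range by linarith
  then have B: "0 < B" using assms by (simp add: zero_less_mult_iff)
  define s where "s = m * C / B"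
  have sB: "s * B = m * C" using B by (simp add: s_def)
  have "2 * m * s * C \<le> m * A + s\<^sup>2 * B"
    using range B by (intro tangent) (auto simp: s_def field_simps)
  then have "B * (2 * m * s * C) \<le> B * (m * A + s\<^sup>2 * B)" using B by simp
  also have "B * (m * A + s\<^sup>2 * B) = m * (A * B) + (s * B)\<^sup>2" by algebra
  also have "B * (2 * m * s * C) = 2 * m * C * (s * B)" by algebra
  finally have "m * (m * C\<^sup>2) \<le> m * (A * B)"
    unfolding sB by (simp add: algebra_simps power2_eq_square)
  then show ?thesis using assms by simp
qed

text \<open>The inequality of arithmetic and geometric means for \<open>m * A\<close> and
  \<open>s^2 * B\<close>.\<close>

lemma hyperbola_cone_tangent:
  fixes m s A B C :: real
  assumes "0 < m" "0 \<le> A" "0 \<le> B" "m * C\<^sup>2 \<le> A * B"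
  shows "2 * m * s * C \<le> m * A + s\<^sup>2 * B"
proof (rule power2_le_imp_le)
  have "(2 * m * s * C)\<^sup>2 = 4 * m * s\<^sup>2 * (m * C\<^sup>2)" by algebra
  also have "\<dots> \<le> 4 * m * s\<^sup>2 * (A * B)" using assms by (intro mult_left_mono) auto
  also have "\<dots> \<le> (m * A + s\<^sup>2 * B)\<^sup>2"
  proof -
    have "(m * A + s\<^sup>2 * B)\<^sup>2 - 4 * m * s\<^sup>2 * (A * B) = (m * A - s\<^sup>2 * B)\<^sup>2" by algebra
    then show ?thesis using zero_le_power2[of "m * A - s\<^sup>2 * B"] by linarith
  qed
  finally show "(2 * m * s * C)\<^sup>2 \<le> (m * A + s\<^sup>2 * B)\<^sup>2" .
qed (use assms in auto)

text \<open>A product inequality describes a double cone; the linear condition selects the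
  nappe.\<close>

lemma nonneg_factors:
  fixes A B c :: real
  assumes AB: "0 \<le> A * B" and sum: "0 \<le> A + c * B" and c: "0 < c"
  shows "0 \<le> A \<and> 0 \<le> B"
proof (cases "A \<le> 0 \<and> B \<le> 0")
  case True
  then have "c * B \<le> 0" using c by (simp add: mult_nonneg_nonpos)
  with sum True have "A = 0" "c * B = 0" by linarith+
  then show ?thesis using c by simp
qed (use AB in \<open>auto simp: zero_le_mult_iff\<close>)

section \<open>Region D and coordinates adapted to the two cones\<close>

text \<open>Here \<open>k\<close> stands for \<open>lz / ly\<close>, so that \<open>lz\<close>
  becomes the product \<open>k * ly\<close>. The last assumption is the square root bound of region
  D in polynomial form.\<close>

locale box_in_region_D =
  fixes lx ly k uz :: real
  assumes ly_pos: "0 < ly" and ly_le: "ly \<le> uz" and uz_less: "uz < 1"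
    and k_pos: "0 < k" and lx_ge: "k * ly \<le> lx" and lx_less: "lx < k" and k_le: "k \<le> uz * ly"
begin

abbreviation "lz \<equiv> k * ly"

text \<open>Coordinates in which the cones become \<open>u v \<ge> uz (z - lz)\<^sup>2\<close> (apex \<open>P\<close>) and
  \<open>u v \<ge> lz (uz - z)\<^sup>2\<close> (apex \<open>P'\<close>): a point on the ruling from the apex to \<open>(X, Y)\<close> on the arc has
  \<open>(u, v)\<close> proportional to \<open>(X, Y)\<close>.\<close>

definition "u_below x z = (uz - lz) * x - k * (uz - z)"
definition "v_below y z = (uz - lz) * y - ly * (uz - z)"
definition "u_above x z = uz * (uz - z) - (uz - lz) * (uz - x)"
definition "v_above y z = (uz - z) - (uz - lz) * (1 - y)"

lemmas cone_coordinates = u_below_def v_below_def u_above_def v_above_def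

abbreviation "F \<equiv> bilinear_set lx ly lz uz"

lemma parameter_bounds:
  "0 < uz" "ly < 1" "k < uz" "k < 1" "k < ly" "lz < uz" "lz < k" "0 < lz" "0 < lx" "lx < uz"
proof -
  show uz: "0 < uz" using ly_pos ly_le by linarith
  show ly: "ly < 1" using ly_le uz_less by linarith
  have "uz * ly < uz" "uz * ly < ly" using uz ly uz_less ly_pos by auto
  then show k: "k < uz" "k < ly" using k_le by linarith+
  then show "k < 1" using uz_less by linarith
  show "lz < k" using ly k_pos by simp
  then show "lz < uz" using k by linarith
  show lz: "0 < lz" using ly_pos k_pos by simp
  then show "0 < lx" using lx_ge by linarith
  show "lx < uz" using k lx_less by linarith
qed

lemma line_eq:
  "line_a ly lz uz + line_b ly lz uz * x = ly + (1 - ly) * (x - k) / (uz - k)"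
proof -
  have d: "uz * ly - lz = ly * (uz - k)" "uz * ly\<^sup>2 - lz = ly * (uz * ly - k)"
    by (simp_all add: algebra_simps power2_eq_square)
  have "line_a ly lz uz = (uz * ly - k) / (uz - k)" "line_b ly lz uz = (1 - ly) / (uz - k)"
    using ly_pos unfolding line_a_def line_b_def d by simp_all
  moreover have "(uz * ly - k) / (uz - k) + (1 - ly) / (uz - k) * x = ly + (1 - ly) * (x - k) / (uz - k)"
    using parameter_bounds(3) by (simp add: divide_simps) algebra
  ultimately show ?thesis by simp
qed

lemma below_line_iff:
  "y \<le> line_a ly lz uz + line_b ly lz uz * x \<longleftrightarrow> (y - ly) * (uz - k) \<le> (1 - ly) * (x - k)"
proof -
  have "y \<le> ly + w / (uz - k) \<longleftrightarrow> (y - ly) * (uz - k) \<le> w" for w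
    using parameter_bounds(3) pos_le_divide_eq[of "uz - k" "y - ly" w] by auto
  then show ?thesis by (simp add: line_eq)
qed

lemma above_line_iff:
  "line_a ly lz uz + line_b ly lz uz * x \<le> y \<longleftrightarrow> (1 - ly) * (x - k) \<le> (y - ly) * (uz - k)"
proof -
  have "ly + w / (uz - k) \<le> y \<longleftrightarrow> w \<le> (y - ly) * (uz - k)" for w
    using parameter_bounds(3) pos_divide_le_eq[of "uz - k" w "y - ly"] by auto
  then show ?thesis by (simp add: line_eq)
qed

lemma soc_below_line_iff:
  "soc_below_line ly lz uz x y z \<longleftrightarrow> uz * (z - lz)\<^sup>2 \<le> u_below x z * v_below y z"
proof -
  have "uz * (x - k) + k * (z - ly * x) = u_below x z" "uz * (y - ly) + ly * (z - k * y) = v_below y z"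
    by (simp_all add: cone_coordinates algebra_simps)
  then show ?thesis using ly_pos by (simp add: soc_below_line_def)
qed

text \<open>Squaring the root leaves a sign condition on the right-hand side. The difference of the
  squares, scaled by \<open>uz - lz\<close>, is four times the defect of the cone
  inequality.\<close>

lemma soc_above_line_iff:
  "soc_above_line lz uz x y z \<longleftrightarrow>
     lz * (uz - z)\<^sup>2 \<le> u_above x z * v_above y z \<and> 0 \<le> x + uz * y - 2 * z"
proof -
  define q r where "q = quad_form (M2 lz uz) (vector [uz - x, 1 - y])" and "r = x + uz * y - 2 * z"
  have "0 \<le> q"
    using pos_semidef_M2[of lz uz] parameter_bounds by (simp add: pos_semidef_def q_def)
  then have "sqrt q \<le> r \<longleftrightarrow> q \<le> r\<^sup>2 \<and> 0 \<le> r"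
    using sqrt_le_D[of q r] real_le_lsqrt[of r q] real_sqrt_ge_zero[of q] by linarith
  moreover have "q \<le> r\<^sup>2 \<longleftrightarrow> lz * (uz - z)\<^sup>2 \<le> u_above x z * v_above y z"
  proof -
    have "(uz - lz) * (r\<^sup>2 - q) = 4 * (u_above x z * v_above y z - lz * (uz - z)\<^sup>2)"
      unfolding q_def r_def quad_form_M2 cone_coordinates vector_2
      by (simp add: algebra_simps power2_eq_square)
    moreover have "0 \<le> (uz - lz) * (r\<^sup>2 - q) \<longleftrightarrow> 0 \<le> r\<^sup>2 - q"
      using parameter_bounds(6) mult_le_cancel_left_pos[of "uz - lz" 0 "r\<^sup>2 - q"] by simp
    ultimately have "0 \<le> r\<^sup>2 - q \<longleftrightarrow> 0 \<le> 4 * (u_above x z * v_above y z - lz * (uz - z)\<^sup>2)"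
      by metis
    then show ?thesis by simp
  qed
  ultimately show ?thesis by (simp add: soc_above_line_def q_def r_def)
qed

section \<open>Necessity: the constraints hold on the hull\<close>

text \<open>For fixed \<open>y\<close>, the defect times \<open>y\<close> is affine in
  \<open>z\<close>. At \<open>z = uz\<close> it is a multiple of \<open>(uz - s * y)^2\<close>; at
  \<open>z = lz\<close> its sign is that of \<open>(y - ly) * (s^2 * y - uz * k)\<close>,
  nonnegative by \<open>k \<le> uz * ly\<close>.\<close>

lemma below_tangent_on_F:
  assumes "(x, y, z) \<in> F" "uz \<le> s"
  shows "2 * uz * s * (z - lz) \<le> uz * u_below x z + s\<^sup>2 * v_below y z"
proof -
  have z: "z = x * y" and y: "ly \<le> y" and zb: "lz \<le> z" "z \<le> uz"
    using assms by (auto simp: bilinear_set_def)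
  have "uz * k \<le> uz * (uz * ly)" using k_le parameter_bounds by simp
  also have "\<dots> = uz\<^sup>2 * ly" by algebra
  also have "\<dots> \<le> s\<^sup>2 * y" using assms y parameter_bounds ly_pos by (intro mult_mono power_mono) auto
  finally have "0 \<le> (uz - z) * (y - ly) * (s\<^sup>2 * y - uz * k) + (z - lz) * (uz - s * y)\<^sup>2"
    using y zb by simp
  also have "\<dots> = y * (uz * u_below x z + s\<^sup>2 * v_below y z - 2 * uz * s * (z - lz))"
    unfolding z cone_coordinates by algebra
  finally show ?thesis using y ly_pos by (simp add: zero_le_mult_iff)
qed

text \<open>The two levels exchange roles: the square appears at \<open>z = lz\<close>, and at
  \<open>z = uz\<close> region D enters through
  \<open>t^2 * y \<le> k^2 \<le> lz * uz\<close>.\<close>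

lemma above_tangent_on_F:
  assumes "(x, y, z) \<in> F" "0 \<le> t" "t \<le> k"
  shows "2 * lz * t * (uz - z) \<le> lz * u_above x z + t\<^sup>2 * v_above y z"
proof -
  have z: "z = x * y" and y: "ly \<le> y" "y \<le> 1" and zb: "lz \<le> z" "z \<le> uz"
    using assms by (auto simp: bilinear_set_def)
  have "t\<^sup>2 * y \<le> k\<^sup>2 * 1" using assms y ly_pos by (intro mult_mono power_mono) auto
  also have "\<dots> \<le> k * (uz * ly)" using k_le k_pos by (simp add: power2_eq_square)
  also have "\<dots> = lz * uz" by algebra
  finally have "0 \<le> (uz - z) * (lz - t * y)\<^sup>2 + (z - lz) * (1 - y) * (lz * uz - t\<^sup>2 * y)"
    using y zb by simp
  also have "\<dots> = y * (lz * u_above x z + t\<^sup>2 * v_above y z - 2 * lz * t * (uz - z))"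
    unfolding z cone_coordinates by algebra
  finally show ?thesis using y ly_pos by (simp add: zero_le_mult_iff)
qed

lemma F_linear_constraints:
  assumes "(x, y, z) \<in> F"
  shows "lz \<le> z" "z \<le> uz" "ly \<le> y" "y \<le> 1" "rlt_constraints lx ly x y z"
proof -
  have F: "z = x * y" "lx \<le> x" "x \<le> 1" "ly \<le> y" "y \<le> 1" "lz \<le> z" "z \<le> uz"
    using assms by (auto simp: bilinear_set_def)
  then show "lz \<le> z" "z \<le> uz" "ly \<le> y" "y \<le> 1" by auto
  have "0 \<le> (1 - x) * (1 - y)" "0 \<le> (x - lx) * (y - ly)" "0 \<le> (x - lx) * (1 - y)" "0 \<le> (1 - x) * (y - ly)"
    using F by auto
  then show "rlt_constraints lx ly x y z"
    unfolding rlt_constraints_def F(1) by (simp add: algebra_simps)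
qed

lemma hull_linear_constraints:
  assumes p: "(x, y, z) \<in> convex hull F"
  shows "lz \<le> z" "z \<le> uz" "ly \<le> y" "y \<le> 1" "rlt_constraints lx ly x y z"
    and "uz \<le> s \<Longrightarrow> 2 * uz * s * (z - lz) \<le> uz * u_below x z + s\<^sup>2 * v_below y z"
    and "0 \<le> t \<Longrightarrow> t \<le> k \<Longrightarrow> 2 * lz * t * (uz - z) \<le> lz * u_above x z + t\<^sup>2 * v_above y z"
proof -
  note halfspace = convex_hull_halfspace[OF p] and F = F_linear_constraints
  show "lz \<le> z" using halfspace[of lz 0 0 1] F(1) by simp
  show "z \<le> uz" using halfspace[of "-uz" 0 0 "-1"] F(2) by simp
  show "ly \<le> y" using halfspace[of ly 0 1 0] F(3) by simp
  show "y \<le> 1" using halfspace[of "-1" 0 "-1" 0] F(4) by simp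
  show "rlt_constraints lx ly x y z"
    using halfspace[of "-1" "-1" "-1" 1] halfspace[of "- lx * ly" "- ly" "- lx" 1]
      halfspace[of lx 1 lx "-1"] halfspace[of ly ly 1 "-1"] F(5)
    by (fastforce simp: rlt_constraints_def)
  show "2 * uz * s * (z - lz) \<le> uz * u_below x z + s\<^sup>2 * v_below y z" if "uz \<le> s"
  proof -
    \<comment> \<open>These are the coefficients of the tangent inequality expanded in
      \<open>x\<close>, \<open>y\<close>, \<open>z\<close>, the form in which it passes to the
      hull.\<close>
    let ?a = "uz * (uz - lz)" and ?b = "s\<^sup>2 * (uz - lz)" and ?c = "uz * k + s\<^sup>2 * ly - 2 * uz * s"
      and ?e = "uz * k * uz + s\<^sup>2 * ly * uz - 2 * uz * s * lz"
    have eq: "uz * u_below x z + s\<^sup>2 * v_below y z - 2 * uz * s * (z - lz) = ?a * x + ?b * y + ?c * z - ?e"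
      for x y z unfolding cone_coordinates by algebra
    have "?e \<le> ?a * x + ?b * y + ?c * z" if "(x, y, z) \<in> F" for x y z
      using below_tangent_on_F[OF that \<open>uz \<le> s\<close>] eq[of x z y] by linarith
    from halfspace[OF this] show ?thesis using eq[of x z y] by linarith
  qed
  show "2 * lz * t * (uz - z) \<le> lz * u_above x z + t\<^sup>2 * v_above y z" if "0 \<le> t" "t \<le> k"
  proof -
    let ?a = "lz * (uz - lz)" and ?b = "t\<^sup>2 * (uz - lz)" and ?c = "2 * lz * t - lz * uz - t\<^sup>2"
      and ?e = "2 * lz * t * uz - lz * uz * uz + lz * (uz - lz) * uz - t\<^sup>2 * uz + t\<^sup>2 * (uz - lz)"
    have eq: "lz * u_above x z + t\<^sup>2 * v_above y z - 2 * lz * t * (uz - z) = ?a * x + ?b * y + ?c * z - ?e"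
      for x y z unfolding cone_coordinates by algebra
    have "?e \<le> ?a * x + ?b * y + ?c * z" if "(x, y, z) \<in> F" for x y z
      using above_tangent_on_F[OF that \<open>0 \<le> t\<close> \<open>t \<le> k\<close>] eq[of x z y] by linarith
    from halfspace[OF this] show ?thesis using eq[of x z y] by linarith
  qed
qed

text \<open>The plane of the last RLT constraint contains the apex \<open>P\<close>, so it is
  homogeneous in these coordinates.\<close>

lemma rlt_below_coordinates:
  assumes "rlt_constraints lx ly x y z"
  shows "(uz + ly) * (z - lz) \<le> v_below y z + ly * u_below x z"
proof -
  have "0 \<le> (uz - lz) * (ly * x + y - ly - z)"
    using assms parameter_bounds(6) by (simp add: rlt_constraints_def)
  also have "\<dots> = v_below y z + ly * u_below x z - (uz + ly) * (z - lz)"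
    unfolding cone_coordinates by algebra
  finally show ?thesis by simp
qed

text \<open>Likewise the plane of the third RLT constraint contains the apex
  \<open>P'\<close>.\<close>

lemma rlt_above_coordinates:
  assumes "rlt_constraints lx ly x y z"
  shows "(lz + lx) * (uz - z) \<le> u_above x z + lx * v_above y z"
proof -
  have "0 \<le> (uz - lz) * (x + lx * y - lx - z)"
    using assms parameter_bounds(6) by (simp add: rlt_constraints_def)
  also have "\<dots> = u_above x z + lx * v_above y z - (lz + lx) * (uz - z)"
    unfolding cone_coordinates by algebra
  finally show ?thesis by simp
qed

lemma hull_soc_below:
  assumes p: "(x, y, z) \<in> convex hull F" and line: "(y - ly) * (uz - k) \<le> (1 - ly) * (x - k)"
  shows "uz * (z - lz)\<^sup>2 \<le> u_below x z * v_below y z"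
proof -
  define A B C where "A = u_below x z" and "B = v_below y z" and "C = z - lz"
  note lin = hull_linear_constraints[OF p]
  have C: "0 \<le> C" using lin(1) by (simp add: C_def)
  have B: "ly * C \<le> B"
  proof -
    have "B - ly * C = (uz - lz) * (y - ly)" unfolding B_def C_def cone_coordinates by algebra
    also have "\<dots> \<ge> 0" using lin(3) parameter_bounds(6) by simp
    finally show ?thesis by simp
  qed
  have rlt: "(uz + ly) * C \<le> B + ly * A"
    using rlt_below_coordinates[OF lin(5)] by (simp add: A_def B_def C_def)
  have tangent: "2 * uz * s * C \<le> uz * A + s\<^sup>2 * B" if "uz \<le> s" for s
    using lin(6)[OF that] by (simp add: A_def B_def C_def)
  \<comment> \<open>The tangency parameter is \<open>uz * C / B\<close>. It lies on the arc in the
    middle case; otherwise the dividing plane (first case) or the RLT plane through \<open>P\<close>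
    (last case) takes over.\<close>
  consider "C < B" | "B \<le> C" "uz * C \<le> B" | "B < uz * C" by linarith
  then have "uz * C\<^sup>2 \<le> A * B"
  proof cases
    case 1
    have "(uz - lz) * ((1 - ly) * (x - k) - (y - ly) * (uz - k)) =
        (1 - ly) * (A - uz * C) - (uz - k) * (B - C)"
      unfolding A_def B_def C_def cone_coordinates by algebra
    moreover have "0 \<le> (uz - lz) * ((1 - ly) * (x - k) - (y - ly) * (uz - k))"
      using line parameter_bounds(6) by simp
    moreover have "0 \<le> (uz - k) * (B - C)" using 1 parameter_bounds by simp
    ultimately have "0 \<le> (1 - ly) * (A - uz * C)" by linarith
    then have "uz * C \<le> A" using parameter_bounds(2) by (simp add: zero_le_mult_iff)
    then have "(uz * C) * C \<le> A * B"
      using 1 C parameter_bounds by (intro mult_mono) (auto intro: order_trans[of 0 "uz * C"])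
    then show ?thesis by (simp add: power2_eq_square mult.assoc)
  next
    case 2
    show ?thesis
      by (rule hyperbola_cone_from_tangents[where a = uz and b = 1])
        (use 2 C parameter_bounds tangent in auto)
  next
    case 3
    have "0 \<le> B" using B C ly_pos by (smt (verit) mult_nonneg_nonneg)
    have "0 \<le> (B + ly * A - (uz + ly) * C) * B" using rlt \<open>0 \<le> B\<close> by simp
    moreover have "0 \<le> (uz * C - B) * (B - ly * C)" using 3 B by simp
    \<comment> \<open>On the RLT plane the cone defect is a quadratic in \<open>B\<close> with roots
      \<open>uz * C\<close> and \<open>ly * C\<close>.\<close>
    moreover have "ly * (A * B - uz * C\<^sup>2) =
        (B + ly * A - (uz + ly) * C) * B + (uz * C - B) * (B - ly * C)" by algebra
    ultimately have "0 \<le> ly * (A * B - uz * C\<^sup>2)" by linarith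
    then show ?thesis using ly_pos by (simp add: zero_le_mult_iff)
  qed
  then show ?thesis by (simp add: A_def B_def C_def)
qed

lemma hull_soc_above:
  assumes p: "(x, y, z) \<in> convex hull F" and line: "(1 - ly) * (x - k) \<le> (y - ly) * (uz - k)"
  shows "lz * (uz - z)\<^sup>2 \<le> u_above x z * v_above y z" "0 \<le> x + uz * y - 2 * z"
proof -
  define A B C where "A = u_above x z" and "B = v_above y z" and "C = uz - z"
  note lin = hull_linear_constraints[OF p]
  have C: "0 \<le> C" using lin(2) by (simp add: C_def)
  have BC: "B \<le> C"
  proof -
    have "C - B = (uz - lz) * (1 - y)" unfolding B_def C_def cone_coordinates by algebra
    also have "\<dots> \<ge> 0" using lin(4) parameter_bounds(6) by simp
    finally show ?thesis by simp
  qed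
  have rlt: "(lz + lx) * C \<le> A + lx * B"
    using rlt_above_coordinates[OF lin(5)] by (simp add: A_def B_def C_def)
  have tangent: "2 * lz * t * C \<le> lz * A + t\<^sup>2 * B" if "0 \<le> t" "t \<le> k" for t
    using lin(7)[OF that] by (simp add: A_def B_def C_def)
  have tangent_k: "0 \<le> ly * A + k * B - 2 * lz * C"
  proof -
    have "0 \<le> k * (ly * A + k * B - 2 * lz * C)"
      using tangent[of k] k_pos by (simp add: algebra_simps power2_eq_square)
    then show ?thesis using k_pos by (simp add: zero_le_mult_iff)
  qed
  have line': "0 \<le> (1 - ly) * (k * C - A) + (uz - k) * (B - ly * C)"
  proof -
    have "(1 - ly) * (k * C - A) + (uz - k) * (B - ly * C) =
        (uz - lz) * ((y - ly) * (uz - k) - (1 - ly) * (x - k))"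
      unfolding A_def B_def C_def cone_coordinates by algebra
    also have "\<dots> \<ge> 0" using line parameter_bounds(6) by simp
    finally show ?thesis .
  qed
  \<comment> \<open>Adding \<open>ly\<close> times the line condition to \<open>1 - ly\<close> times
    the tangent at \<open>t = k\<close> eliminates \<open>A\<close>. Hence the tangency parameter
    \<open>lz * C / B\<close> cannot exceed \<open>k\<close>, and only its lower end
    \<open>lx\<close> needs a case split.\<close>
  have B: "ly * C \<le> B"
  proof (rule ccontr)
    assume "\<not> ly * C \<le> B"
    then have "ly * C - B > 0" by simp
    moreover have "0 \<le> ly * ((1 - ly) * (k * C - A) + (uz - k) * (B - ly * C))
        + (1 - ly) * (ly * A + k * B - 2 * lz * C)"
      using line' tangent_k ly_pos parameter_bounds(2) by simp
    moreover have "\<dots> = - (ly * (uz - k) + k * (1 - ly)) * (ly * C - B)" by algebra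
    moreover have "0 < ly * (uz - k) + k * (1 - ly)"
      using ly_pos k_pos parameter_bounds by (simp add: add_pos_pos)
    ultimately show False by (smt (verit) mult_pos_pos mult_minus_left)
  qed
  have B0: "0 \<le> B" using B C ly_pos by (smt (verit) mult_nonneg_nonneg)
  have A0: "0 \<le> A"
    using tangent[of 0] k_pos parameter_bounds(8) by (simp add: zero_le_mult_iff)
  have cone: "lz * C\<^sup>2 \<le> A * B"
  proof (cases "lx * B \<le> lz * C")
    case True
    show ?thesis
    proof (rule hyperbola_cone_from_tangents[where a = lx and b = k])
      show "lz * C \<le> k * B" using B k_pos by simp
    qed (use True C parameter_bounds k_pos lx_less tangent in auto)
  next
    case False
    have "0 \<le> (A + lx * B - (lz + lx) * C) * B" using rlt B0 by simp
    moreover have "0 \<le> (lx * B - lz * C) * (C - B)" using False BC by simp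
    moreover have "A * B - lz * C\<^sup>2 =
        (A + lx * B - (lz + lx) * C) * B + (lx * B - lz * C) * (C - B)" by algebra
    ultimately show ?thesis by linarith
  qed
  then show "lz * (uz - z)\<^sup>2 \<le> u_above x z * v_above y z" by (simp add: A_def B_def C_def)
  \<comment> \<open>The sign condition comes from the tangent at \<open>s = lz\<close>, after
    raising the weight of \<open>B\<close> from \<open>lz\<close> to \<open>uz\<close>.\<close>
  have "2 * lz * lz * C \<le> lz * A + lz\<^sup>2 * B"
    by (rule hyperbola_cone_tangent[OF _ A0 B0 cone]) (use parameter_bounds in auto)
  then have "0 \<le> lz * (A + lz * B - 2 * lz * C)" by (simp add: algebra_simps power2_eq_square)
  then have "2 * lz * C \<le> A + lz * B" using parameter_bounds(8) by (simp add: zero_le_mult_iff)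
  also have "\<dots> \<le> A + uz * B" using B0 parameter_bounds(6) by (simp add: mult_right_mono)
  finally have "0 \<le> (uz - lz) * (x + uz * y - 2 * z)"
    unfolding A_def B_def C_def cone_coordinates by (simp add: algebra_simps)
  then show "0 \<le> x + uz * y - 2 * z" using parameter_bounds(6) by (simp add: zero_le_mult_iff)
qed

section \<open>Sufficiency: the three bodies lie in the hull\<close>

lemma lower_arc_in_F: "lx \<le> t \<Longrightarrow> t \<le> k \<Longrightarrow> (t, lz / t, lz) \<in> F"
  using parameter_bounds lx_ge ly_pos k_pos
    mult_left_mono[of t k ly] by (auto simp: bilinear_set_def field_simps)

lemma upper_arc_in_F: "uz \<le> t \<Longrightarrow> t \<le> 1 \<Longrightarrow> (t, uz / t, uz) \<in> F"
  using parameter_bounds lx_ge ly_pos ly_le mult_right_mono[of t 1 ly]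
    mult_mono[of t 1 ly uz] by (auto simp: bilinear_set_def field_simps)

lemma vertices_in_F:
  "(k, ly, lz) \<in> F" "(lx, lz / lx, lz) \<in> F" "(lx, 1, lx) \<in> F"
  "(uz, 1, uz) \<in> F" "(1, uz, uz) \<in> F" "(1, ly, ly) \<in> F"
proof -
  show "(k, ly, lz) \<in> F" using lower_arc_in_F[of k] lx_less k_pos by simp
  show "(lx, lz / lx, lz) \<in> F" using lower_arc_in_F[of lx] lx_less by simp
  show "(uz, 1, uz) \<in> F" using upper_arc_in_F[of uz] uz_less parameter_bounds(1) by simp
  show "(1, uz, uz) \<in> F" using upper_arc_in_F[of 1] uz_less by simp
  show "(lx, 1, lx) \<in> F"
    unfolding bilinear_set_def mem_Collect_eq prod.case
    by (intro conjI) (use parameter_bounds uz_less lx_ge ly_le in linarith)+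
  show "(1, ly, ly) \<in> F"
    unfolding bilinear_set_def mem_Collect_eq prod.case
    by (intro conjI) (use parameter_bounds uz_less lx_ge ly_le in linarith)+
qed

text \<open>Projection from \<open>P\<close> to the level \<open>uz\<close> gives
  \<open>(u / C, v / C)\<close> with \<open>C = z - lz\<close>, a point of the lens; the given point
  divides the segment from \<open>P\<close> to it with weight \<open>C / (uz - lz)\<close>.\<close>

lemma below_cone_in_hull:
  assumes C: "lz < z" "z \<le> uz" and A: "0 \<le> u_below x z" and B: "0 \<le> v_below y z"
    and cone: "uz * (z - lz)\<^sup>2 \<le> u_below x z * v_below y z"
    and chord: "u_below x z + v_below y z \<le> (1 + uz) * (z - lz)"
  shows "(x, y, z) \<in> convex hull F"
proof -
  let ?A = "u_below x z" and ?B = "v_below y z" and ?C = "z - lz" and ?d = "uz - lz"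
  have C0: "0 < ?C" "0 < ?d" using C parameter_bounds by auto
  have "0 < uz * ?C\<^sup>2" using C0 parameter_bounds(1) by simp
  then have "?A \<noteq> 0" using cone by auto
  then have "0 < ?A / ?C" using A C0 by simp
  moreover have "uz \<le> ?A / ?C * (?B / ?C)"
    using cone C0 by (simp add: pos_le_divide_eq power2_eq_square)
  moreover have "uz * (?A / ?C) + uz * 1 * (?B / ?C) \<le> uz * (uz + 1)"
  proof -
    have "?A / ?C + ?B / ?C \<le> 1 + uz"
      unfolding add_divide_distrib[symmetric] using chord C0 by (simp add: pos_divide_le_eq)
    then have "uz * (?A / ?C + ?B / ?C) \<le> uz * (1 + uz)" using parameter_bounds(1) by simp
    then show ?thesis by (simp add: algebra_simps)
  qed
  ultimately have "(?A / ?C, ?B / ?C, uz) \<in> convex hull F"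
    using hyperbola_lens[of "convex hull F" uz uz 1 uz "?A / ?C" "?B / ?C"]
      parameter_bounds(1) uz_less upper_arc_in_F hull_inc[of _ F convex] by auto
  from convexD_alt[OF convex_convex_hull hull_inc[OF vertices_in_F(1)] this, of "?C / ?d"]
  have "(1 - ?C / ?d) *\<^sub>R (k, ly, lz) + (?C / ?d) *\<^sub>R (?A / ?C, ?B / ?C, uz) \<in> convex hull F"
    using C0 C by simp
  moreover have "(1 - ?C / ?d) * k + ?C / ?d * (?A / ?C) = x"
  proof -
    have "?A = ?d * (x - k) + k * ?C" unfolding cone_coordinates by algebra
    then show ?thesis using C0 by (simp add: divide_simps) (simp add: algebra_simps)
  qed
  moreover have "(1 - ?C / ?d) * ly + ?C / ?d * (?B / ?C) = y"
  proof -
    have "?B = ?d * (y - ly) + ly * ?C" unfolding cone_coordinates by algebra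
    then show ?thesis using C0 by (simp add: divide_simps) (simp add: algebra_simps)
  qed
  moreover have "(1 - ?C / ?d) * lz + ?C / ?d * uz = z"
    using C0 by (simp add: divide_simps) (simp add: algebra_simps)
  ultimately show ?thesis by simp
qed

text \<open>The same projection, from \<open>P'\<close> to the level \<open>lz\<close>.\<close>

lemma above_cone_in_hull:
  assumes C: "lz \<le> z" "z < uz" and A: "0 \<le> u_above x z" and B: "0 \<le> v_above y z"
    and cone: "lz * (uz - z)\<^sup>2 \<le> u_above x z * v_above y z"
    and chord: "ly * u_above x z + lx * v_above y z \<le> (lx * ly + lz) * (uz - z)"
  shows "(x, y, z) \<in> convex hull F"
proof -
  let ?A = "u_above x z" and ?B = "v_above y z" and ?C = "uz - z" and ?d = "uz - lz"
  have C0: "0 < ?C" "0 < ?d" using C parameter_bounds by auto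
  have "0 < lz * ?C\<^sup>2" using C0 ly_pos k_pos by simp
  then have "?A \<noteq> 0" using cone by auto
  then have "0 < ?A / ?C" using A C0 by simp
  moreover have "lz \<le> ?A / ?C * (?B / ?C)"
    using cone C0 by (simp add: pos_le_divide_eq power2_eq_square)
  moreover have "lz * (?A / ?C) + lx * k * (?B / ?C) \<le> lz * (lx + k)"
  proof -
    have "(ly * ?A + lx * ?B) / ?C \<le> lx * ly + lz"
      using chord C0 by (simp add: pos_divide_le_eq)
    then have "ly * (?A / ?C) + lx * (?B / ?C) \<le> lx * ly + lz" by (simp add: add_divide_distrib)
    \<comment> \<open>The factor \<open>k\<close> turns \<open>ly\<close> into \<open>lz\<close>,
      matching the chord with end points over \<open>lx\<close> and \<open>k\<close>.\<close>
    from mult_left_mono[OF this, of k] show ?thesis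
      using k_pos unfolding distrib_left by (simp only: mult_ac less_imp_le)
  qed
  ultimately have "(?A / ?C, ?B / ?C, lz) \<in> convex hull F"
    using hyperbola_lens[of "convex hull F" lz lx k lz "?A / ?C" "?B / ?C"]
      parameter_bounds lx_less lower_arc_in_F hull_inc[of _ F convex] by auto
  from convexD_alt[OF convex_convex_hull hull_inc[OF vertices_in_F(4)] this, of "?C / ?d"]
  have "(1 - ?C / ?d) *\<^sub>R (uz, 1, uz) + (?C / ?d) *\<^sub>R (?A / ?C, ?B / ?C, lz) \<in> convex hull F"
    using C0 C by simp
  moreover have "(1 - ?C / ?d) * uz + ?C / ?d * (?A / ?C) = x"
  proof -
    have "?A = ?d * (x - uz) + uz * ?C" unfolding cone_coordinates by algebra
    then show ?thesis using C0 by (simp add: divide_simps) (simp add: algebra_simps)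
  qed
  moreover have "(1 - ?C / ?d) * 1 + ?C / ?d * (?B / ?C) = y"
  proof -
    have "?B = ?d * (y - 1) + ?C" unfolding cone_coordinates by algebra
    then show ?thesis using C0 by (simp add: divide_simps) (simp add: algebra_simps)
  qed
  moreover have "(1 - ?C / ?d) * uz + ?C / ?d * lz = z"
    using C0 by (simp add: divide_simps) (simp add: algebra_simps)
  ultimately show ?thesis by simp
qed

text \<open>The faces of the three tetrahedra that do not contain the edge \<open>PP'\<close> lie in
  RLT planes. The planes through that edge are the two chord planes, given as hypotheses, and two
  internal walls, whose sides are the cases.\<close>

lemma polytope_in_hull:
  assumes rlt: "rlt_constraints lx ly x y z"
    and below: "(1 + uz) * (z - lz) \<le> u_below x z + v_below y z"
    and above: "(lx * ly + lz) * (uz - z) \<le> ly * u_above x z + lx * v_above y z"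
  shows "(x, y, z) \<in> convex hull F"
proof -
  define ry where "ry = lz / lx"
  have lx_ry: "lx * ry = lz" using parameter_bounds(9) by (simp add: ry_def)
  have ry_le: "ry \<le> 1" using parameter_bounds(9) lx_ge by (simp add: ry_def)
  define p p1 p2 q r e f :: "real \<times> real \<times> real" where "p = (x, y, z)" and "p1 = (k, ly, lz)" and "p2 = (uz, 1, uz)"
    and "q = (1, uz, uz)" and "r = (lx, ry, lz)" and "e = (lx, 1, lx)" and "f = (1, ly, ly)"
  note points = p_def p1_def p2_def q_def r_def e_def f_def
  have V: "p1 \<in> convex hull F" "p2 \<in> convex hull F" "q \<in> convex hull F"
    "r \<in> convex hull F" "e \<in> convex hull F" "f \<in> convex hull F"
    unfolding points ry_def by (intro hull_inc vertices_in_F)+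
  \<comment> \<open>These signed volumes tell the side of the walls \<open>PP'E\<close> and
    \<open>PP'G\<close>; the vertices \<open>E\<close> and \<open>G\<close> themselves are called
    \<open>e\<close> and \<open>f\<close> here.\<close>
  define E G where "E = tet_volume p1 e p2 p" and "G = tet_volume p1 p p2 f"
  have swap: "tet_volume p1 e p p2 = - E" "tet_volume p1 p e p2 = E"
    "tet_volume p1 p2 p f = - G" "tet_volume p1 p2 f p = G"
    unfolding E_def G_def points tet_volume.simps by algebra+
  note pb = parameter_bounds
  have Q1: "0 \<le> z - x - y + 1" and Q2: "0 \<le> z - ly * x - lx * y + lx * ly"
    and T1: "0 \<le> x + lx * y - lx - z" and T2: "0 \<le> ly * x + y - ly - z"
    using rlt by (auto simp: rlt_constraints_def)
  have above_r: "0 \<le> tet_volume p1 p r p2"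
  proof -
    have "lx * tet_volume p1 p r p2 =
        (k - lx) * (ly * u_above x z + lx * v_above y z - (lx * ly + lz) * (uz - z))"
      using lx_ry unfolding points tet_volume.simps cone_coordinates by algebra
    also have "\<dots> \<ge> 0" using above lx_less by simp
    finally show ?thesis using pb(9) by (simp add: zero_le_mult_iff)
  qed
  have below_q: "0 \<le> tet_volume p1 p2 q p"
  proof -
    have "tet_volume p1 p2 q p = (1 - uz) * (u_below x z + v_below y z - (1 + uz) * (z - lz))"
      unfolding points tet_volume.simps cone_coordinates by algebra
    also have "\<dots> \<ge> 0" using below uz_less by simp
    finally show ?thesis .
  qed
  consider "E < 0" | "0 \<le> E" "0 \<le> G" | "G < 0" by linarith
  then have "p \<in> convex hull F"
  proof cases
    case 1
    have "tet_volume p1 e r p2 = (1 - ry) * ((uz - lx) * (k - lx) * (1 - ly))"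
      using lx_ry unfolding points tet_volume.simps by algebra
    moreover have "ry \<noteq> 1" \<comment> \<open>the tetrahedron is flat if \<open>lx = lz\<close>, but then this case is void\<close>
    proof
      assume "ry = 1"
      then have "r = e" using lx_ry by (simp add: points)
      then show False using above_r 1 swap(2) by simp
    qed
    ultimately have vol: "0 < tet_volume p1 e r p2" using ry_le pb lx_less by simp
    have "tet_volume p e r p2 = (1 - ry) * (uz - lx) * (x + lx * y - lx - z)"
      using lx_ry unfolding points tet_volume.simps by algebra
    moreover have "tet_volume p1 e r p = (k - lx) * (1 - ry) * (z - ly * x - lx * y + lx * ly)"
      using lx_ry unfolding points tet_volume.simps by algebra
    ultimately have "0 \<le> tet_volume p e r p2" "0 \<le> tet_volume p1 e r p"
      using T1 Q2 ry_le lx_less pb(10) by simp_all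
    then show ?thesis
      using convex_tetrahedron[OF convex_convex_hull V(1) V(5) V(4) V(2) vol] above_r swap(1) 1 by simp
  next
    case 2
    have "tet_volume p1 e p2 f = (uz - lx) * (1 - ly) * ((1 - k) * (1 - ly))"
      unfolding points tet_volume.simps by algebra
    then have vol: "0 < tet_volume p1 e p2 f" using pb by simp
    have "tet_volume p e p2 f = (uz - lx) * (1 - ly) * (z - x - y + 1)"
      unfolding points tet_volume.simps by algebra
    moreover have "tet_volume p1 e p f = (1 - ly) * (1 - k) * (z - ly * x - lx * y + lx * ly)"
      unfolding points tet_volume.simps by algebra
    ultimately have "0 \<le> tet_volume p e p2 f" "0 \<le> tet_volume p1 e p f"
      using Q1 Q2 pb by simp_all
    then show ?thesis
      using convex_tetrahedron[OF convex_convex_hull V(1) V(5) V(2) V(6) vol] 2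
      by (simp add: E_def G_def)
  next
    case 3
    have "tet_volume p1 p2 q f = (1 - uz) * (uz - ly) * ((1 - k) * (1 - ly))"
      unfolding points tet_volume.simps by algebra
    \<comment> \<open>For \<open>ly = uz\<close> the points \<open>Q\<close> and \<open>G\<close>
      coincide and the tetrahedron is flat, but then \<open>below_q\<close> excludes this
      case.\<close>
    moreover have "ly \<noteq> uz"
    proof
      assume "ly = uz"
      then have "q = f" by (simp add: points)
      then show False using below_q 3 swap(4) by simp
    qed
    ultimately have vol: "0 < tet_volume p1 p2 q f" using pb uz_less ly_le by simp
    have "tet_volume p p2 q f = (1 - uz) * (uz - ly) * (z - x - y + 1)"
      unfolding points tet_volume.simps by algebra
    moreover have "tet_volume p1 p q f = (1 - k) * (uz - ly) * (ly * x + y - ly - z)"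
      unfolding points tet_volume.simps by algebra
    ultimately have "0 \<le> tet_volume p p2 q f" "0 \<le> tet_volume p1 p q f"
      using Q1 T2 pb uz_less ly_le by simp_all
    then show ?thesis
      using convex_tetrahedron[OF convex_convex_hull V(1) V(2) V(3) V(6) vol] below_q swap(3) 3 by simp
  qed
  then show ?thesis by (simp add: p_def)
qed

section \<open>From the constraints to membership in the hull\<close>

text \<open>The nappe is selected by the RLT plane through \<open>P\<close>.\<close>

lemma below_cone_nonneg:
  assumes "rlt_constraints lx ly x y z" "lz \<le> z"
    and cone: "uz * (z - lz)\<^sup>2 \<le> u_below x z * v_below y z"
  shows "0 \<le> u_below x z" "0 \<le> v_below y z"
proof -
  have "0 \<le> (uz + ly) * (z - lz)" using assms(2) ly_pos parameter_bounds(1) by simp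
  then have "0 \<le> v_below y z + ly * u_below x z" using rlt_below_coordinates[OF assms(1)] by simp
  moreover have "0 \<le> uz * (z - lz)\<^sup>2" using parameter_bounds(1) by simp
  then have "0 \<le> v_below y z * u_below x z" using cone by (simp add: mult.commute)
  ultimately show "0 \<le> u_below x z" "0 \<le> v_below y z"
    using nonneg_factors[OF _ _ ly_pos] by blast+
qed

text \<open>The nappe is selected by the sign condition left over from the square root.\<close>

lemma above_cone_nonneg:
  assumes "z \<le> uz" "0 \<le> x + uz * y - 2 * z"
    and cone: "lz * (uz - z)\<^sup>2 \<le> u_above x z * v_above y z"
  shows "0 \<le> u_above x z" "0 \<le> v_above y z"
proof -
  have "u_above x z + uz * v_above y z = 2 * lz * (uz - z) + (uz - lz) * (x + uz * y - 2 * z)"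
    unfolding cone_coordinates by algebra
  also have "\<dots> \<ge> 0"
    using assms parameter_bounds(6) ly_pos k_pos by (intro add_nonneg_nonneg mult_nonneg_nonneg) auto
  finally have "0 \<le> u_above x z + uz * v_above y z" .
  moreover have "0 \<le> lz * (uz - z)\<^sup>2" using ly_pos k_pos by simp
  then have "0 \<le> u_above x z * v_above y z" using cone by linarith
  ultimately show "0 \<le> u_above x z" "0 \<le> v_above y z"
    using nonneg_factors[OF _ _ parameter_bounds(1)] by blast+
qed

text \<open>The three affine forms in each of the next two identities all vanish on the edge joining
  the two apices, so any one of them is a combination of the other two.\<close>

lemma below_chord_plane:
  assumes line: "(1 - ly) * (x - k) \<le> (y - ly) * (uz - k)"
    and "0 \<le> u_above x z" "0 \<le> v_above y z"
    and cone: "lz * (uz - z)\<^sup>2 \<le> u_above x z * v_above y z"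
  shows "(1 + uz) * (z - lz) \<le> u_below x z + v_below y z"
proof -
  \<comment> \<open>\<open>T\<close> is nonnegative on one side of the plane tangent to the cone
    with apex \<open>P'\<close> along the ruling through \<open>P\<close>, hence the parameter
    \<open>k\<close>.\<close>
  define T where "T = lz * u_above x z + k\<^sup>2 * v_above y z - 2 * lz * k * (uz - z)"
  have T: "0 \<le> T"
    using hyperbola_cone_tangent[OF parameter_bounds(8) assms(2,3) cone, of k] by (simp add: T_def)
  define W where "W = k * (ly * (uz - k) + k * (1 - ly))"
  have W: "0 < W" using ly_pos k_pos parameter_bounds by (simp add: W_def add_pos_pos)
  have "W * (u_below x z + v_below y z - (1 + uz) * (z - lz)) =
      (1 - k + (uz - ly)) * T +
      k * ((uz - lz) * (ly - k) * ((y - ly) * (uz - k) - (1 - ly) * (x - k)))"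
    unfolding W_def T_def cone_coordinates by algebra
  also have "\<dots> \<ge> 0"
    by (intro add_nonneg_nonneg mult_nonneg_nonneg)
      (use T line parameter_bounds ly_le k_pos in linarith)+
  finally show ?thesis
    using W mult_left_le_imp_le[of W 0 "u_below x z + v_below y z - (1 + uz) * (z - lz)"] by simp
qed

lemma above_chord_plane:
  assumes line: "(y - ly) * (uz - k) \<le> (1 - ly) * (x - k)"
    and "0 \<le> u_below x z" "0 \<le> v_below y z"
    and cone: "uz * (z - lz)\<^sup>2 \<le> u_below x z * v_below y z"
  shows "(lx * ly + lz) * (uz - z) \<le> ly * u_above x z + lx * v_above y z"
proof -
  \<comment> \<open>Now the plane is tangent to the cone with apex \<open>P\<close> along the ruling
    through \<open>P'\<close>, hence the parameter \<open>uz\<close>.\<close>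
  define T where "T = uz * u_below x z + uz\<^sup>2 * v_below y z - 2 * uz * uz * (z - lz)"
  have T: "0 \<le> T"
    using hyperbola_cone_tangent[OF parameter_bounds(1) assms(2,3) cone, of uz] by (simp add: T_def)
  define W where "W = uz * (uz * (1 - ly) + (uz - k))"
  have W: "0 < W" using parameter_bounds by (simp add: W_def add_pos_pos)
  have "W * (ly * u_above x z + lx * v_above y z - (lx * ly + lz) * (uz - z)) =
      (ly * (uz - k) + lx * (1 - ly)) * T +
      uz * ((uz - lz) * (uz * ly - lx) * ((1 - ly) * (x - k) - (y - ly) * (uz - k)))"
    unfolding W_def T_def cone_coordinates by algebra
  also have "\<dots> \<ge> 0"
    by (intro add_nonneg_nonneg mult_nonneg_nonneg)
      (use T line parameter_bounds ly_pos k_le lx_less in linarith)+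
  finally show ?thesis
    using W mult_left_le_imp_le[of W 0 "ly * u_above x z + lx * v_above y z - (lx * ly + lz) * (uz - z)"]
    by simp
qed

text \<open>On either side of the dividing plane only one cone constraint is available. It puts
  points beyond its own chord plane into the cone body; for the rest, its tangent along
  \<open>PP'\<close> supplies the other chord inequality, so the polytope contains them.\<close>

lemma constraints_in_hull:
  assumes rlt: "rlt_constraints lx ly x y z" and z: "lz \<le> z" "z \<le> uz"
    and below: "(y - ly) * (uz - k) \<le> (1 - ly) * (x - k) \<Longrightarrow> soc_below_line ly lz uz x y z"
    and above: "(1 - ly) * (x - k) \<le> (y - ly) * (uz - k) \<Longrightarrow> soc_above_line lz uz x y z"
  shows "(x, y, z) \<in> convex hull F"
proof (cases "(y - ly) * (uz - k) \<le> (1 - ly) * (x - k)")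
  case True
  have cone: "uz * (z - lz)\<^sup>2 \<le> u_below x z * v_below y z"
    using below[OF True] by (simp add: soc_below_line_iff)
  note nonneg = below_cone_nonneg[OF rlt z(1) cone]
  show ?thesis
  proof (cases "(1 + uz) * (z - lz) \<le> u_below x z + v_below y z")
    case inside: True
    show ?thesis
      by (rule polytope_in_hull[OF rlt inside above_chord_plane[OF True nonneg cone]])
  next
    case False
    \<comment> \<open>At the apex level the chord inequality would hold trivially.\<close>
    then have "z \<noteq> lz" using nonneg by auto
    then show ?thesis using below_cone_in_hull[OF _ z(2) nonneg cone] z False by auto
  qed
next
  case False
  then have line: "(1 - ly) * (x - k) \<le> (y - ly) * (uz - k)" by simp
  have cone: "lz * (uz - z)\<^sup>2 \<le> u_above x z * v_above y z" "0 \<le> x + uz * y - 2 * z"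
    using above[OF line] by (simp_all add: soc_above_line_iff)
  note nonneg = above_cone_nonneg[OF z(2) cone(2,1)]
  show ?thesis
  proof (cases "(lx * ly + lz) * (uz - z) \<le> ly * u_above x z + lx * v_above y z")
    case inside: True
    show ?thesis
      by (rule polytope_in_hull[OF rlt below_chord_plane[OF line nonneg cone(1)] inside])
  next
    case outside: False
    have "0 \<le> ly * u_above x z + lx * v_above y z"
      using nonneg ly_pos parameter_bounds(9) by simp
    then have "z \<noteq> uz" using outside by auto
    then show ?thesis using above_cone_in_hull[OF z(1) _ nonneg cone(1)] z outside by auto
  qed
qed

theorem convex_hull_F:
  "convex hull F =
    {(x, y, z).
       rlt_constraints lx ly x y z \<and> lz \<le> z \<and> z \<le> uz \<and>
       (y \<le> line_a ly lz uz + line_b ly lz uz * x \<longrightarrow> soc_below_line ly lz uz x y z) \<and>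
       (y \<ge> line_a ly lz uz + line_b ly lz uz * x \<longrightarrow> soc_above_line lz uz x y z)}"
  (is "_ = ?R")
proof (intro equalityI subsetI)
  fix p assume "p \<in> convex hull F"
  then obtain x y z where p: "p = (x, y, z)" "(x, y, z) \<in> convex hull F" by (cases p) auto
  show "p \<in> ?R"
    unfolding p(1) mem_Collect_eq prod.case below_line_iff above_line_iff
      soc_below_line_iff soc_above_line_iff
    using hull_linear_constraints(1,2,5)[OF p(2)] hull_soc_below[OF p(2)] hull_soc_above[OF p(2)]
    by blast
next
  fix p assume "p \<in> ?R"
  moreover obtain x y z where p: "p = (x, y, z)" by (cases p)
  ultimately show "p \<in> convex hull F"
    unfolding p mem_Collect_eq prod.case below_line_iff above_line_iff
    using constraints_in_hull by blast
qed

end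

theorem proposition9:
  fixes lx ly lz uz :: real
  assumes "0 < lz" and "lz < uz" and "uz < 1"
    and "lz \<le> lx" and "lx \<le> uz"
    and "lz \<le> ly" and "ly \<le> uz"
    and "lx * ly < lz"
    and "region_D lx ly lz uz"
  shows "pos_semidef (M2 lz uz) \<and>
    convex hull (bilinear_set lx ly lz uz) =
      {(x, y, z).
         rlt_constraints lx ly x y z \<and>
         lz \<le> z \<and> z \<le> uz \<and>
         (y \<le> line_a ly lz uz + line_b ly lz uz * x \<longrightarrow> soc_below_line ly lz uz x y z) \<and>
         (y \<ge> line_a ly lz uz + line_b ly lz uz * x \<longrightarrow> soc_above_line lz uz x y z)}"
proof
  show "pos_semidef (M2 lz uz)" using assms by (intro pos_semidef_M2) auto
  define k where "k = lz / ly"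
  have ly: "0 < ly" using assms by linarith
  then have lz: "lz = k * ly" by (simp add: k_def)
  have "box_in_region_D lx ly k uz"
  proof
    show "0 < k" using assms ly by (simp add: k_def)
    show "lx < k" using assms ly by (simp add: k_def pos_less_divide_eq)
    have "lz / uz \<le> ly\<^sup>2" using assms(9) by (auto simp: region_D_def intro: sqrt_le_D)
    then have "lz \<le> uz * ly * ly" using assms by (simp add: pos_divide_le_eq power2_eq_square mult_ac)
    then show "k \<le> uz * ly" using ly by (simp add: k_def pos_divide_le_eq)
  qed (use assms ly lz in auto)
  from box_in_region_D.convex_hull_F[OF this]
  show "convex hull (bilinear_set lx ly lz uz) =
      {(x, y, z).
         rlt_constraints lx ly x y z \<and>
         lz \<le> z \<and> z \<le> uz \<and>
         (y \<le> line_a ly lz uz + line_b ly lz uz * x \<longrightarrow> soc_below_line ly lz uz x y z) \<and>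
         (y \<ge> line_a ly lz uz + line_b ly lz uz * x \<longrightarrow> soc_above_line lz uz x y z)}"
    unfolding lz[symmetric] .
qed

end
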